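(* Let $\dim_H$ denote Hausdorff dimension. (i) For $p\geq2$ let $\alpha_p$ be the unique root in $(1,2)$ of $x^{p-1}(x-1)=1$. Then $\dim_H\eta(\mathcal{T}_p)=\frac{\log\alpha_p}{\log 2}$ for all $p\geq2$. (ii) For integers $2\leq p<q$ let $\gamma_{p,q}$ be the unique root in $(0,1)$ of $x^p+x^{p+1}+\cdots+x^q=1$. Then $\dim_H\eta(\mathcal{T}_p\cap\mathcal{D}_q)=\frac{\log(1/\gamma_{p,q})}{\log2}$. (iii) For $q\geq3$, $\dim_H\eta(\mathcal{D}_q)\geq\frac{\log(1/\gamma_{2,q})}{\log2}$.
   Context: For integers $k_1\geq 2$, $k_2,\ldots,k_r\geq 1$, $\zeta^{\star}(k_1,\ldots,k_r)=\sum_{n_1\geq\cdots\geq n_r\geq 1}\frac{1}{n_1^{k_1}\cdots n_r^{k_r}}$. $\mathcal{T}$ is the set of infinite sequences $\mathbf{k}=(k_1,k_2,\ldots)$ of positive integers with $k_1\geq2$ and such that if $k_1=2$ then $k_s\geq2$ for some $s\geq2$. For $\mathbf{k}\in\mathcal{T}$, $\eta(\mathbf{k})=\lim_{r\to\infty}\zeta^{\star}(k_1,\ldots,k_r)$ (this limit exists). For $p\geq2$, $\mathcal{T}_p=\{\mathbf{k}\in\mathcal{T}: k_i\geq p\ \forall i\}$ and $\mathcal{D}_p=\{\mathbf{k}\in\mathcal{T}: k_i\leq p\ \forall i\}$. *)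

theory Defs
  imports "HOL-Analysis.Analysis"
begin

definition zeta_star :: "nat list \<Rightarrow> real" where
  "zeta_star ks = infsum (\<lambda>ns. \<Prod>i<length ks. 1 / real (ns ! i) ^ (ks ! i))
     {ns :: nat list. length ns = length ks \<and> sorted_wrt (\<ge>) ns \<and> (\<forall>n\<in>set ns. 1 \<le> n)}"

(* infinite sequences k = (k_1,k_2,...) are functions nat => nat with k_1 = k 0 *)
definition T_set :: "(nat \<Rightarrow> nat) set" where
  "T_set = {k. (\<forall>i. 1 \<le> k i) \<and> 2 \<le> k 0 \<and> (k 0 = 2 \<longrightarrow> (\<exists>s\<ge>1. 2 \<le> k s))}"

definition eta :: "(nat \<Rightarrow> nat) \<Rightarrow> real" where
  "eta k = lim (\<lambda>r. zeta_star (map k [0..<r]))"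

definition T_p :: "nat \<Rightarrow> (nat \<Rightarrow> nat) set" where
  "T_p p = {k \<in> T_set. \<forall>i. p \<le> k i}"

definition D_p :: "nat \<Rightarrow> (nat \<Rightarrow> nat) set" where
  "D_p p = {k \<in> T_set. \<forall>i. k i \<le> p}"

definition hausdorff_pre :: "real \<Rightarrow> real \<Rightarrow> real set \<Rightarrow> ennreal" where
  "hausdorff_pre s \<delta> A =
     (INF U \<in> {U :: nat \<Rightarrow> real set. A \<subseteq> (\<Union>i. U i) \<and> (\<forall>i. bounded (U i) \<and> diameter (U i) \<le> \<delta>)}.
        (\<Sum>i. ennreal (diameter (U i) powr s)))"

definition hausdorff_measure :: "real \<Rightarrow> real set \<Rightarrow> ennreal" where
  "hausdorff_measure s A = (SUP \<delta> \<in> {0<..}. hausdorff_pre s \<delta> A)"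

definition hausdorff_dim :: "real set \<Rightarrow> real" where
  "hausdorff_dim A = Inf {s. 0 < s \<and> hausdorff_measure s A = 0}"

end

theory Submission
  imports Defs
begin

text \<open>
  When all entries are at least 2, the part of the series for \<open>\<eta>(k) - \<eta>(l)\<close> in which the
  variables of a common prefix \<open>w\<close> of \<open>k\<close> and \<open>l\<close> all equal 2 dominates: variables equal to 1
  cancel, and larger variables contribute a convergent product independent of \<open>w\<close>. Hence \<open>\<eta>\<close> maps
  the cylinder of \<open>w\<close> to a set of diameter at most \<open>6 \<cdot> 2\<^sup>-\<^sup>|\<^sup>w\<^sup>|\<close>, where \<open>|w|\<close> is the sum of the
  entries, and two sequences separating after \<open>w\<close> have images at distance at least a constant times
  \<open>2\<^sup>-\<^sup>|\<^sup>w\<^sup>|\<close> if the alphabet is finite. So \<open>\<eta>(A\<^sup>\<nat>)\<close> behaves like a self-similar set with ratios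
  \<open>2\<^sup>-\<^sup>a\<close> for \<open>a\<close> in \<open>A\<close>, and its dimension is the \<open>s\<close> at which \<open>\<Sum>\<^sub>a 2\<^sup>-\<^sup>s\<^sup>a\<close> crosses 1. The infinite
  alphabet of (i) is exhausted by finite ones, and (iii) follows from (ii) by monotonicity.
\<close>

section \<open>Truncated sums\<close>

text \<open>The cut-off bounds the outermost, hence largest, variable. Prepending a letter is then a
  positive linear operator on functions of \<open>n\<close>, so estimates propagate through a prefix
  by induction.\<close>

primrec zsum :: "nat list \<Rightarrow> nat \<Rightarrow> real" where
  "zsum [] n = 1"
| "zsum (k # ks) n = (\<Sum>m=1..n. zsum ks m / real m ^ k)"

lemma zsum_nonneg: "0 \<le> zsum ks n"
  by (induction ks arbitrary: n) (auto intro!: sum_nonneg)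

lemma zsum_mono: "m \<le> n \<Longrightarrow> zsum ks m \<le> zsum ks n"
  by (cases ks) (auto intro!: sum_mono2 simp: zsum_nonneg)

definition antitone_lists :: "nat \<Rightarrow> nat \<Rightarrow> nat list set" where
  "antitone_lists r n = {ns. length ns = r \<and> sorted_wrt (\<ge>) ns \<and> (\<forall>m\<in>set ns. 1 \<le> m \<and> m \<le> n)}"

lemma antitone_lists_0: "antitone_lists 0 n = {[]}"
  by (auto simp: antitone_lists_def)

lemma antitone_lists_Suc:
  "antitone_lists (Suc r) n = (\<Union>m\<in>{1..n}. (#) m ` antitone_lists r m)"
  by (fastforce simp: antitone_lists_def length_Suc_conv image_iff)

lemma finite_antitone_lists: "finite (antitone_lists r n)"
  by (induction r arbitrary: n) (auto simp: antitone_lists_0 antitone_lists_Suc)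

lemma sum_antitone_lists:
  "(\<Sum>ns\<in>antitone_lists (length ks) n. \<Prod>i<length ks. 1 / real (ns ! i) ^ (ks ! i)) = zsum ks n"
proof (induction ks arbitrary: n)
  case Nil
  then show ?case by (simp add: antitone_lists_0)
next
  case (Cons k ks)
  have "(\<Sum>ns\<in>antitone_lists (length (k # ks)) n. \<Prod>i<length (k # ks). 1 / real (ns ! i) ^ ((k # ks) ! i))
      = (\<Sum>m=1..n. \<Sum>ns\<in>(#) m ` antitone_lists (length ks) m.
          \<Prod>i<Suc (length ks). 1 / real (ns ! i) ^ ((k # ks) ! i))"
    unfolding list.size antitone_lists_Suc add_Suc_right add_0_right
    by (rule sum.UNION_disjoint) (auto simp: finite_antitone_lists)
  also have "\<dots> = (\<Sum>m=1..n. \<Sum>ns\<in>antitone_lists (length ks) m.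
          1 / real m ^ k * (\<Prod>i<length ks. 1 / real (ns ! i) ^ (ks ! i)))"
    by (rule sum.cong[OF refl], subst sum.reindex)
       (auto simp: prod.lessThan_Suc_shift simp del: prod.lessThan_Suc)
  also have "\<dots> = (\<Sum>m=1..n. 1 / real m ^ k * zsum ks m)"
    by (simp only: sum_distrib_left[symmetric] Cons.IH)
  finally show ?case by simp
qed

text \<open>All terms are nonnegative and the sets \<open>antitone_lists (length ks) n\<close>
  exhaust the index set of \<open>zeta_star\<close>, so the bounded increasing truncations converge
  to its \<open>infsum\<close>.\<close>

lemma zsum_tendsto_zeta_star:
  assumes bdd: "\<And>n. zsum ks n \<le> C"
  shows "zsum ks \<longlonglongrightarrow> zeta_star ks"
proof -
  define f where "f ns = (\<Prod>i<length ks. 1 / real (ns ! i) ^ (ks ! i))" for ns :: "nat list"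
  define S where "S = {ns :: nat list. length ns = length ks \<and> sorted_wrt (\<ge>) ns \<and> (\<forall>n\<in>set ns. 1 \<le> n)}"
  have f_nonneg: "0 \<le> f ns" for ns
    by (auto simp: f_def intro!: prod_nonneg)
  have sum_eq: "sum f (antitone_lists (length ks) n) = zsum ks n" for n
    unfolding f_def by (rule sum_antitone_lists)
  have sub_S: "antitone_lists (length ks) n \<subseteq> S" for n
    by (auto simp: antitone_lists_def S_def)
  have sub_antitone: "\<exists>n. F \<subseteq> antitone_lists (length ks) n" if F: "finite F" "F \<subseteq> S" for F
  proof (intro exI[of _ "\<Sum>ns\<in>F. sum_list ns"] subsetI)
    fix ns assume ns: "ns \<in> F"
    have "m \<le> (\<Sum>ns\<in>F. sum_list ns)" if "m \<in> set ns" for m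
      using member_le_sum[of ns F sum_list] member_le_sum_list[OF that] F ns by auto
    then show "ns \<in> antitone_lists (length ks) (\<Sum>ns\<in>F. sum_list ns)"
      using F ns by (auto simp: S_def antitone_lists_def)
  qed
  have "convergent (zsum ks)"
    by (rule Bseq_monoseq_convergent)
       (auto intro!: BseqI'[where K=C] incseq_imp_monoseq zsum_mono
             simp: incseq_def zsum_nonneg bdd)
  then obtain L where L: "zsum ks \<longlonglongrightarrow> L"
    by (auto simp: convergent_def)
  have le_L: "zsum ks n \<le> L" for n
    by (rule incseq_le[OF _ L]) (auto simp: incseq_def intro: zsum_mono)
  have fin_le: "sum f F \<le> L" if F: "finite F" "F \<subseteq> S" for F
  proof -
    obtain n where n: "F \<subseteq> antitone_lists (length ks) n"
      using sub_antitone[OF F] by blast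
    then have "sum f F \<le> sum f (antitone_lists (length ks) n)"
      by (intro sum_mono2) (auto simp: finite_antitone_lists f_nonneg)
    then show ?thesis
      using le_L[of n] sum_eq by simp
  qed
  have sm: "f summable_on S"
    by (rule nonneg_bdd_above_summable_on) (auto simp: f_nonneg bdd_above_def intro!: fin_le exI[of _ L])
  have "infsum f S = L"
  proof (rule antisym)
    show "infsum f S \<le> L"
      by (rule infsum_le_finite_sums[OF sm]) (rule fin_le)
    have "zsum ks n \<le> infsum f S" for n
      using finite_sum_le_infsum[OF sm finite_antitone_lists sub_S] f_nonneg sum_eq by auto
    then show "L \<le> infsum f S"
      by (intro LIMSEQ_le_const2[OF L]) auto
  qed
  then show ?thesis
    using L unfolding zeta_star_def f_def S_def by simp
qed

section \<open>Two-sided estimates for truncated sums with letters at least 2\<close>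

lemma zsum_Suc_0 [simp]: "zsum ks (Suc 0) = 1"
  by (induction ks) auto

lemma zsum_ge_1: "1 \<le> n \<Longrightarrow> 1 \<le> zsum ks n"
  using zsum_mono[of 1 n ks] by simp

lemma sum_telescope_2: "(\<Sum>m=1..n. 2 / (real m * (real m + 1))) = 2 * real n / (real n + 1)"
proof (induction n)
  case (Suc n)
  have "2 * real n / (real n + 1) + 2 / ((real n + 1) * (real n + 1 + 1)) = 2 * (real n + 1) / (real n + 1 + 1)"
    by (simp add: divide_simps) (simp add: algebra_simps)
  then show ?case using Suc by (simp add: add_ac)
qed simp

text \<open>The bound is a fixed point of prepending the letter 2: divided by \<open>m^2\<close> it
  gives the terms of \<open>sum_telescope_2\<close>. Larger letters only decrease the sum.\<close>

lemma zsum_le: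
  assumes "\<forall>k\<in>set ks. 2 \<le> k" "1 \<le> n"
  shows "zsum ks n \<le> 2 * real n / (real n + 1)"
  using assms
proof (induction ks arbitrary: n)
  case Nil
  then show ?case by (simp add: field_simps)
next
  case (Cons k ks)
  have "zsum (k # ks) n \<le> (\<Sum>m=1..n. 2 / (real m * (real m + 1)))"
    unfolding zsum.simps
  proof (rule sum_mono)
    fix m assume m: "m \<in> {1..n}"
    have "zsum ks m / real m ^ k \<le> (2 * real m / (real m + 1)) / real m ^ 2"
      using Cons m by (intro frac_le power_increasing) auto
    also have "\<dots> = 2 / (real m * (real m + 1))"
      using m by (simp add: divide_simps power2_eq_square)
    finally show "zsum ks m / real m ^ k \<le> 2 / (real m * (real m + 1))" .
  qed
  then show ?case unfolding sum_telescope_2 .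
qed

lemma zsum_le_2:
  assumes "\<forall>k\<in>set ks. 2 \<le> k"
  shows "zsum ks n \<le> 2"
proof (cases "n = 0")
  case True
  then show ?thesis by (cases ks) auto
next
  case False
  then have "zsum ks n \<le> 2 * real n / (real n + 1)"
    using assms by (intro zsum_le) auto
  also have "\<dots> \<le> 2" by (simp add: field_simps)
  finally show ?thesis .
qed

text \<open>
  Up to a factor, the partial product \<open>\<Prod>\<^sub>m (1 - (2/m)\<^sup>2)\<^sup>-\<^sup>1\<close> over \<open>3 \<le> m \<le> n\<close> in closed form,
  normalised to \<open>gap 1 = 0\<close> and \<open>gap 2 = 1\<close>. It is the eigenvector in \<open>sum_gap\<close>, which makes the
  bound \<open>zsum_append_diff_le\<close> reproduce itself when a letter is prepended.
\<close>
definition gap :: "nat \<Rightarrow> real" where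
  "gap n = 6 * real n * (real n - 1) / ((real n + 1) * (real n + 2))"

lemma gap_le_6: "gap n \<le> 6"
proof -
  have "(real n + 1) * (real n + 2) > 0" by simp
  then show ?thesis
    unfolding gap_def by (subst pos_divide_le_eq) (auto simp: algebra_simps)
qed

lemma gap_ge_1:
  assumes "2 \<le> n"
  shows "1 \<le> gap n"
proof -
  have "0 \<le> (5 * real n + 1) * (real n - 2)" using assms by simp
  then show ?thesis by (simp add: gap_def field_simps)
qed

lemma gap_nonneg: "1 \<le> n \<Longrightarrow> 0 \<le> gap n"
  by (simp add: gap_def)

lemma sum_gap: "(\<Sum>m=1..n. 4 * gap m / real m ^ 2) = gap n"
proof (induction n)
  case 0
  then show ?case by (simp add: gap_def)
next
  case (Suc n)
  have pos: "real n + 1 \<noteq> 0" "real n + 2 \<noteq> 0" "real n + 3 \<noteq> 0" by auto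
  have "gap n + 4 * gap (Suc n) / real (Suc n) ^ 2 = gap (Suc n)"
    unfolding gap_def of_nat_Suc using pos
    by (simp add: divide_simps add.assoc) (simp add: algebra_simps power2_eq_square)
  then show ?case using Suc by simp
qed

lemma half_power_sum_list_Cons: "(1/2 :: real) ^ sum_list (k # ks) = (1/2) ^ k * (1/2) ^ sum_list ks"
  by (simp add: power_add)

text \<open>Induction on the prefix. With no prefix, both sums equal 1 at \<open>n = 1\<close>;
  otherwise they lie in [1,2] while \<open>gap n\<close> is at least 1. A letter \<open>k\<close>
  contributes a factor \<open>(1/2)^k\<close>, and \<open>sum_gap\<close> absorbs the rest.\<close>

lemma zsum_append_diff_le:
  assumes "\<forall>k\<in>set ks. 2 \<le> k" "\<forall>k\<in>set us. 2 \<le> k" "\<forall>k\<in>set vs. 2 \<le> k" "1 \<le> n"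
  shows "\<bar>zsum (ks @ us) n - zsum (ks @ vs) n\<bar> \<le> (1/2) ^ sum_list ks * gap n"
  using assms
proof (induction ks arbitrary: n)
  case Nil
  show ?case
  proof (cases "n = 1")
    case True
    then show ?thesis by (simp add: gap_def)
  next
    case False
    then show ?thesis
      using Nil gap_ge_1[of n] zsum_ge_1[of n us] zsum_ge_1[of n vs]
        zsum_le_2[of us n] zsum_le_2[of vs n] by (auto simp: abs_le_iff)
  qed
next
  case (Cons k ks)
  let ?d = "\<lambda>m. zsum (ks @ us) m - zsum (ks @ vs) m"
  have "\<bar>zsum ((k # ks) @ us) n - zsum ((k # ks) @ vs) n\<bar> = \<bar>\<Sum>m=1..n. ?d m / real m ^ k\<bar>"
    by (simp add: sum_subtractf diff_divide_distrib)
  also have "\<dots> \<le> (\<Sum>m=1..n. (1/2) ^ sum_list (k # ks) * (4 * gap m / real m ^ 2))"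
  proof (rule order_trans[OF sum_abs sum_mono])
    fix m assume m: "m \<in> {1..n}"
    have IH: "\<bar>?d m\<bar> \<le> (1/2) ^ sum_list ks * gap m"
      using Cons m by auto
    show "\<bar>?d m / real m ^ k\<bar> \<le> (1/2) ^ sum_list (k # ks) * (4 * gap m / real m ^ 2)"
    \<comment> \<open>At \<open>m = 1\<close> the induction hypothesis gives 0 because
      \<open>gap 1 = 0\<close>; for \<open>m >= 2\<close> the base \<open>2/m\<close> is at most 1,
      so the exponent \<open>k\<close> may be lowered to 2.\<close>
    proof (cases "m = 1")
      case True
      then show ?thesis using IH by (simp add: gap_def)
    next
      case False
      then have "(2 / real m) ^ k \<le> (2 / real m) ^ 2"
        using Cons m by (intro power_decreasing) auto
      then have *: "1 / real m ^ k \<le> (1/2) ^ k * (4 / real m ^ 2)"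
        using m by (simp add: power_divide divide_simps)
      have "\<bar>?d m / real m ^ k\<bar> = \<bar>?d m\<bar> * (1 / real m ^ k)"
        by simp
      also have "\<dots> \<le> ((1/2) ^ sum_list ks * gap m) * ((1/2) ^ k * (4 / real m ^ 2))"
        using m by (intro mult_mono IH * mult_nonneg_nonneg) (auto simp: gap_nonneg)
      finally show ?thesis by (simp only: half_power_sum_list_Cons) (simp add: mult_ac)
    qed
  qed
  also have "\<dots> = (1/2) ^ sum_list (k # ks) * gap n"
    by (simp only: sum_distrib_left[symmetric] sum_gap)
  finally show ?case .
qed

text \<open>
  Every summand below is nonnegative, so keeping only the one with all prefix variables equal to 2
  gives the bound.
\<close>
lemma zsum_append_diff_ge:
  assumes "a < b" "\<forall>k\<in>set vs. 2 \<le> k" "2 \<le> n"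
  shows "zsum (ks @ a # us) n - zsum (ks @ b # vs) n \<ge> (1/2) ^ sum_list ks * ((1/2) ^ a / 3)"
proof -
  have "zsum (ks @ b # vs) n \<le> zsum (ks @ a # us) n \<and> (2 \<le> n \<longrightarrow>
     zsum (ks @ a # us) n - zsum (ks @ b # vs) n \<ge> (1/2) ^ sum_list ks * ((1/2) ^ a / 3))" for n
  proof (induction ks arbitrary: n)
    case Nil
    let ?t = "\<lambda>m. zsum us m / real m ^ a - zsum vs m / real m ^ b"
    \<comment> \<open>Uses \<open>a + 1 <= b\<close>. At \<open>m = 2\<close> the factor
      \<open>1 - 2/(m + 1)\<close> is 1/3, the constant in the claim.\<close>
    have t: "?t m \<ge> (1 - 2 / (real m + 1)) / real m ^ a" if "1 \<le> m" for m
    proof -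
      have "zsum vs m / real m ^ b \<le> (2 * real m / (real m + 1)) / real m ^ Suc a"
        using assms that by (intro frac_le zsum_le power_increasing) auto
      also have "\<dots> = (2 / (real m + 1)) / real m ^ a"
        using that by (simp add: divide_simps)
      finally have "zsum vs m / real m ^ b \<le> (2 / (real m + 1)) / real m ^ a" .
      moreover have "zsum us m / real m ^ a \<ge> 1 / real m ^ a"
        using zsum_ge_1[OF that] by (intro divide_right_mono) auto
      ultimately show ?thesis by (simp add: diff_divide_distrib)
    qed
    have t0: "0 \<le> ?t m" if "1 \<le> m" for m
      using that by (intro order_trans[OF _ t[OF that]] divide_nonneg_nonneg) (auto simp: field_simps)
    have eq: "zsum ([] @ a # us) n - zsum ([] @ b # vs) n = (\<Sum>m=1..n. ?t m)"
      by (simp add: sum_subtractf)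
    have "0 \<le> (\<Sum>m=1..n. ?t m)"
      using t0 by (intro sum_nonneg) auto
    moreover have "(1/2) ^ a / 3 \<le> (\<Sum>m=1..n. ?t m)" if "2 \<le> n"
    proof -
      have "(1/2) ^ a / 3 \<le> ?t 2"
        using t[of 2] by (simp add: power_divide)
      also have "\<dots> \<le> (\<Sum>m=1..n. ?t m)"
        by (rule member_le_sum) (use that t0 in auto)
      finally show ?thesis .
    qed
    ultimately show ?case using eq by auto
  next
    case (Cons k ks)
    let ?t = "\<lambda>m. (zsum (ks @ a # us) m - zsum (ks @ b # vs) m) / real m ^ k"
    have t0: "0 \<le> ?t m" for m
      using Cons[of m] by simp
    have eq: "zsum ((k # ks) @ a # us) n - zsum ((k # ks) @ b # vs) n = (\<Sum>m=1..n. ?t m)"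
      by (simp add: sum_subtractf diff_divide_distrib)
    have "0 \<le> (\<Sum>m=1..n. ?t m)"
      using t0 by (intro sum_nonneg) auto
    moreover have "(1/2) ^ sum_list (k # ks) * ((1/2) ^ a / 3) \<le> (\<Sum>m=1..n. ?t m)" if "2 \<le> n"
    proof -
      have "(1/2 :: real) ^ sum_list (k # ks) * ((1/2) ^ a / 3)
          = ((1/2) ^ sum_list ks * ((1/2) ^ a / 3)) / 2 ^ k"
        by (simp only: half_power_sum_list_Cons) (simp add: power_divide mult_ac)
      also have "\<dots> \<le> ?t 2"
        using Cons[of 2] unfolding of_nat_numeral by (intro divide_right_mono) auto
      also have "\<dots> \<le> (\<Sum>m=1..n. ?t m)"
        by (rule member_le_sum) (use that t0 in auto)
      finally show ?thesis .
    qed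
    ultimately show ?case using eq by auto
  qed
  then show ?thesis using assms by blast
qed

lemma zsum_snoc_ge: "zsum ks n \<le> zsum (ks @ [k]) n" if "1 \<le> n"
  using that
proof (induction ks arbitrary: n)
  case Nil
  then show ?case using zsum_ge_1[of n "[k]"] by simp
next
  case (Cons a ks)
  then show ?case by (auto intro!: sum_mono divide_right_mono)
qed

section \<open>Passage to the limit: \<open>zeta_star\<close> and \<open>eta\<close>\<close>

lemma zeta_star_tendsto:
  assumes "\<forall>k\<in>set ks. 2 \<le> k"
  shows "zsum ks \<longlonglongrightarrow> zeta_star ks"
  by (rule zsum_tendsto_zeta_star) (rule zsum_le_2[OF assms])

text \<open>\<open>eta\<close> is a \<open>lim\<close>, hence usable only once convergence is known:
  appending a letter does not decrease the value, and \<open>zsum_le_2\<close> bounds it by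
  2.\<close>

lemma zeta_star_tendsto_eta:
  assumes k: "\<And>i. 2 \<le> k i"
  shows "(\<lambda>r. zeta_star (map k [0..<r])) \<longlonglongrightarrow> eta k"
proof -
  have lim: "zsum (map k [0..<r]) \<longlonglongrightarrow> zeta_star (map k [0..<r])" for r
    by (rule zeta_star_tendsto) (use k in auto)
  have "zeta_star (map k [0..<r]) \<le> zeta_star (map k [0..<Suc r])" for r
    by (rule LIMSEQ_le[OF lim lim]) (auto intro!: exI[of _ 1] zsum_snoc_ge)
  then have inc: "incseq (\<lambda>r. zeta_star (map k [0..<r]))"
    by (rule incseq_SucI)
  have "0 \<le> zeta_star (map k [0..<r])" for r
    by (rule LIMSEQ_le_const[OF lim]) (auto simp: zsum_nonneg)
  moreover have "zeta_star (map k [0..<r]) \<le> 2" for r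
    by (rule LIMSEQ_le_const2[OF lim]) (use k zsum_le_2 in auto)
  ultimately have "Bseq (\<lambda>r. zeta_star (map k [0..<r]))"
    by (intro BseqI'[where K=2]) auto
  then have "convergent (\<lambda>r. zeta_star (map k [0..<r]))"
    using inc by (intro Bseq_monoseq_convergent incseq_imp_monoseq)
  then show ?thesis
    unfolding eta_def by (simp add: convergent_LIMSEQ_iff)
qed

lemma map_upt_prefix:
  assumes "r \<le> R"
  shows "map k [0..<R] = map k [0..<r] @ map k [r..<R]"
  using assms upt_add_eq_append[of 0 r "R - r"] by (simp flip: map_append)

text \<open>\<open>zsum_append_diff_le\<close> in the limit, first in the cut-off \<open>n\<close>,
  then in the word length \<open>R\<close>; the factor 6 bounds \<open>gap\<close>.\<close>

lemma eta_diff_le: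
  assumes k: "\<And>i. 2 \<le> k i" and l: "\<And>i. 2 \<le> l i"
    and pre: "map k [0..<r] = map l [0..<r]"
  shows "\<bar>eta k - eta l\<bar> \<le> 6 * (1/2) ^ sum_list (map k [0..<r])"
proof -
  have "\<bar>zeta_star (map k [0..<R]) - zeta_star (map l [0..<R])\<bar> \<le> 6 * (1/2) ^ sum_list (map k [0..<r])"
    if R: "r \<le> R" for R
  proof (rule LIMSEQ_le_const2)
    show "(\<lambda>n. \<bar>zsum (map k [0..<R]) n - zsum (map l [0..<R]) n\<bar>)
        \<longlonglongrightarrow> \<bar>zeta_star (map k [0..<R]) - zeta_star (map l [0..<R])\<bar>"
      by (intro tendsto_intros zeta_star_tendsto) (use k l in auto)
    have "\<bar>zsum (map k [0..<R]) n - zsum (map l [0..<R]) n\<bar> \<le> 6 * (1/2) ^ sum_list (map k [0..<r])"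
      if n: "1 \<le> n" for n
    proof -
      have "\<bar>zsum (map k [0..<R]) n - zsum (map l [0..<R]) n\<bar> \<le> (1/2) ^ sum_list (map k [0..<r]) * gap n"
        unfolding map_upt_prefix[OF R] pre[symmetric]
        by (rule zsum_append_diff_le) (use k l n in auto)
      also have "\<dots> \<le> (1/2) ^ sum_list (map k [0..<r]) * 6"
        by (intro mult_left_mono gap_le_6) auto
      finally show ?thesis by simp
    qed
    then show "\<exists>N. \<forall>n\<ge>N. \<bar>zsum (map k [0..<R]) n - zsum (map l [0..<R]) n\<bar>
        \<le> 6 * (1/2) ^ sum_list (map k [0..<r])" by blast
  qed
  then show ?thesis
    by (intro LIMSEQ_le_const2[OF tendsto_rabs[OF
          tendsto_diff[OF zeta_star_tendsto_eta[of k, OF k] zeta_star_tendsto_eta[of l, OF l]]]]) auto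
qed

text \<open>So \<open>eta\<close> reverses the lexicographic order, with a quantitative separation
  after the common prefix.\<close>

lemma eta_diff_ge:
  assumes k: "\<And>i. 2 \<le> k i" and l: "\<And>i. 2 \<le> l i"
    and pre: "map k [0..<r] = map l [0..<r]" and less: "k r < l r"
  shows "eta k - eta l \<ge> (1/2) ^ sum_list (map k [0..<r]) * ((1/2) ^ k r / 3)"
proof -
  let ?c = "(1/2) ^ sum_list (map k [0..<r]) * ((1/2) ^ k r / 3) :: real"
  have "zeta_star (map k [0..<R]) - zeta_star (map l [0..<R]) \<ge> ?c"
    if R: "Suc r \<le> R" for R
  proof (rule LIMSEQ_le_const)
    show "(\<lambda>n. zsum (map k [0..<R]) n - zsum (map l [0..<R]) n)
        \<longlonglongrightarrow> zeta_star (map k [0..<R]) - zeta_star (map l [0..<R])"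
      by (intro tendsto_intros zeta_star_tendsto) (use k l in auto)
    have eq: "map m [0..<R] = map m [0..<r] @ m r # map m [Suc r..<R]" for m :: "nat \<Rightarrow> nat"
      using map_upt_prefix[OF R, of m] by simp
    have "zsum (map k [0..<R]) n - zsum (map l [0..<R]) n \<ge> ?c" if n: "2 \<le> n" for n
      unfolding eq pre[symmetric]
      by (rule zsum_append_diff_ge) (use k l n less in auto)
    then show "\<exists>N. \<forall>n\<ge>N. ?c \<le> zsum (map k [0..<R]) n - zsum (map l [0..<R]) n" by blast
  qed
  then show ?thesis
    by (intro LIMSEQ_le_const[OF
          tendsto_diff[OF zeta_star_tendsto_eta[of k, OF k] zeta_star_tendsto_eta[of l, OF l]]]) auto
qed

section \<open>Weights of words\<close>

text \<open>
  The conditional weight of a word \<open>v\<close> is the sum over the extensions \<open>v @ u\<close> among the \<open>w i\<close> of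
  the weight of \<open>u\<close>. As long as it is below 1, some letter can be appended keeping it below 1,
  which produces a sequence without a prefix among the \<open>w i\<close>. This replaces the construction of a
  Bernoulli measure on sequences.
\<close>
lemma prefix_words_sum_ge_1:
  fixes x :: real and w :: "nat \<Rightarrow> nat list"
  assumes fin: "finite A" and x: "0 < x" and ge: "1 \<le> (\<Sum>a\<in>A. x ^ a)"
    and cover: "\<And>k. k \<in> UNIV \<rightarrow> A \<Longrightarrow> \<exists>i r. w i = map k [0..<r]"
  shows "1 \<le> (\<Sum>i. ennreal (x ^ sum_list (w i)))"
proof (rule ccontr)
  define g where "g v i = (if \<exists>u. w i = v @ u
      then ennreal (x ^ sum_list (drop (length v) (w i))) else 0)" for v i
  have g_append: "g v i = ennreal (x ^ sum_list u)" if "w i = v @ u" for v i u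
    using that by (auto simp: g_def)
  have g_0: "g v i = 0" if "\<And>u. w i \<noteq> v @ u" for v i
    using that by (auto simp: g_def)
  have step: "\<exists>a\<in>A. (\<Sum>i. g (v @ [a]) i) < 1" if v: "(\<Sum>i. g v i) < 1" for v
  proof (rule ccontr)
    assume "\<not> ?thesis"
    then have a: "1 \<le> (\<Sum>i. g (v @ [a]) i)" if "a \<in> A" for a
      using that by (meson not_le)
    have term_le: "(\<Sum>a\<in>A. ennreal (x ^ a) * g (v @ [a]) i) \<le> g v i" for i
    proof (cases "\<exists>u. w i = v @ u")
      case True
      then obtain u where u: "w i = v @ u" by blast
      \<comment> \<open>An empty \<open>u\<close> would make \<open>g v i = 1\<close>, against the
        total weight below 1.\<close>
      have "u \<noteq> []"
        using ennreal_suminf_lessD[OF v, of i] g_append[OF u] by auto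
      then obtain b u' where b: "u = b # u'" by (cases u) auto
      \<comment> \<open>Only the letter that follows \<open>v\<close> in \<open>w i\<close>
        contributes, and its factor restores the weight of \<open>u\<close>.\<close>
      have eq: "ennreal (x ^ a) * g (v @ [a]) i = (if a = b then ennreal (x ^ sum_list u) else 0)" for a
      proof (cases "a = b")
        case True
        then have "g (v @ [a]) i = ennreal (x ^ sum_list u')"
          using u b by (intro g_append) simp
        then show ?thesis
          using True b x by (simp add: power_add ennreal_mult')
      next
        case False
        then show ?thesis using u b by (simp add: g_0)
      qed
      show ?thesis
        unfolding eq using fin by (simp add: sum.delta g_append[OF u])
    next
      case False
      then show ?thesis by (simp add: g_0)
    qed
    \<comment> \<open>If every one-letter extension had weight at least 1, combining them with
      factors \<open>x^a\<close> would give \<open>v\<close> weight at least 1.\<close>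
    have "1 \<le> ennreal (\<Sum>a\<in>A. x ^ a)"
      using ge by (metis ennreal_1 ennreal_leI)
    also have "\<dots> = (\<Sum>a\<in>A. ennreal (x ^ a))"
      using x by (subst sum_ennreal) auto
    also have "\<dots> \<le> (\<Sum>a\<in>A. ennreal (x ^ a) * (\<Sum>i. g (v @ [a]) i))"
      using mult_left_mono[OF a] by (intro sum_mono) fastforce
    also have "\<dots> = (\<Sum>i. \<Sum>a\<in>A. ennreal (x ^ a) * g (v @ [a]) i)"
      by (subst suminf_sum) (auto simp: summableI)
    also have "\<dots> \<le> (\<Sum>i. g v i)"
      by (rule suminf_le) (auto intro: summableI term_le)
    finally show False using v by (simp add: not_less[symmetric])
  qed
  assume "\<not> ?thesis"
  moreover have "g [] i = ennreal (x ^ sum_list (w i))" for i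
    by (rule g_append) simp
  ultimately have "(\<Sum>i. g [] i) < 1" by simp
  then obtain f where f: "\<And>n. length (f n) = n \<and> (\<Sum>i. g (f n) i) < 1"
      "\<And>n. \<exists>a\<in>A. f (Suc n) = f n @ [a]"
    using dependent_nat_choice[of "\<lambda>n v. length v = n \<and> (\<Sum>i. g v i) < 1"
        "\<lambda>n v v'. \<exists>a\<in>A. v' = v @ [a]"] step by fastforce
  define k where "k n = last (f (Suc n))" for n
  have k: "k n \<in> A" "f (Suc n) = f n @ [k n]" for n
    using f(2)[of n] by (auto simp: k_def)
  have map_k: "map k [0..<n] = f n" for n
    by (induction n) (use f(1)[of 0] k in auto)
  obtain i r where "w i = map k [0..<r]"
    using cover[of k] k by auto
  \<comment> \<open>A word \<open>w i\<close> that is a prefix of \<open>k\<close> has conditional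
    weight 1 given itself, which the construction of \<open>k\<close> excludes.\<close>
  then have "g (f r) i = 1"
    using g_append[of i "f r" "[]"] map_k by simp
  moreover have "g (f r) i < 1"
    using f(1)[of r] ennreal_suminf_lessD by blast
  ultimately show False by simp
qed

lemma sum_words_power:
  fixes x :: "'a :: comm_semiring_1"
  assumes "finite B"
  shows "(\<Sum>w\<in>{w. set w \<subseteq> B \<and> length w = r}. x ^ sum_list w) = (\<Sum>a\<in>B. x ^ a) ^ r"
proof (induction r)
  case 0
  have "{w :: nat list. set w \<subseteq> B \<and> length w = 0} = {[]}" by auto
  then show ?case by simp
next
  case (Suc r)
  have "(\<Sum>w\<in>{w. set w \<subseteq> B \<and> length w = Suc r}. x ^ sum_list w)
      = (\<Sum>(w, a)\<in>{w. set w \<subseteq> B \<and> length w = r} \<times> B. x ^ sum_list (a # w))"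
    unfolding lists_length_Suc_eq
    by (subst sum.reindex) (auto simp: inj_on_def case_prod_unfold)
  also have "\<dots> = (\<Sum>w\<in>{w. set w \<subseteq> B \<and> length w = r}. x ^ sum_list w) * (\<Sum>a\<in>B. x ^ a)"
    by (simp add: sum_product sum.cartesian_product power_add) (simp add: mult.commute)
  finally show ?case using Suc by (simp add: mult.commute)
qed

lemma powr_neg_power:
  fixes s :: real
  shows "((1/2) ^ n) powr s = (2 powr - s) ^ n"
proof -
  have "((1/2) ^ n) powr s = (2 powr - real n) powr s"
    by (simp add: powr_minus powr_realpow power_divide divide_simps)
  also have "\<dots> = (2 powr - s) powr real n"
    by (simp add: powr_powr mult.commute)
  finally show ?thesis by (simp add: powr_realpow)
qed

lemma length_le_sum_list_upt:
  fixes k :: "nat \<Rightarrow> nat"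
  assumes "\<And>i. 1 \<le> k i"
  shows "r \<le> sum_list (map k [0..<r])"
proof (induction r)
  case (Suc r)
  then show ?case using assms[of r] by simp
qed simp

section \<open>Hausdorff measures and dimensions\<close>

lemma hausdorff_pre_mono: "A \<subseteq> B \<Longrightarrow> hausdorff_pre s \<delta> A \<le> hausdorff_pre s \<delta> B"
  unfolding hausdorff_pre_def by (rule INF_superset_mono) auto

lemma hausdorff_measure_mono: "A \<subseteq> B \<Longrightarrow> hausdorff_measure s A \<le> hausdorff_measure s B"
  unfolding hausdorff_measure_def by (rule SUP_mono) (auto intro: hausdorff_pre_mono)

lemma hausdorff_measure_eq_0I:
  assumes "\<And>\<delta>. 0 < \<delta> \<Longrightarrow> b \<delta> \<longlonglongrightarrow> 0"
    and "\<And>\<delta>. 0 < \<delta> \<Longrightarrow> \<forall>\<^sub>F n in sequentially. hausdorff_pre s \<delta> A \<le> ennreal (b \<delta> n)"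
  shows "hausdorff_measure s A = 0"
proof -
  have "hausdorff_pre s \<delta> A \<le> 0" if "0 < \<delta>" for \<delta>
    using tendsto_lowerbound[OF tendsto_ennrealI[OF assms(1)[OF that]] assms(2)[OF that]] by simp
  then show ?thesis
    unfolding hausdorff_measure_def by (auto simp: SUP_eq_iff intro!: SUP_eqI)
qed

text \<open>The cylinders of words of length \<open>r\<close> form covers of total weight at most
  \<open>6 powr s * \<rho>^r\<close>. As \<open>A\<close> may be infinite, its letter sum is
  controlled through finite subsets.\<close>

lemma hausdorff_measure_eta_eq_0:
  assumes A: "\<And>a. a \<in> A \<Longrightarrow> 2 \<le> a" and s: "0 < s" and \<rho>: "0 \<le> \<rho>" "\<rho> < 1"
    and le: "\<And>B. finite B \<Longrightarrow> B \<subseteq> A \<Longrightarrow> (\<Sum>a\<in>B. (2 powr - s) ^ a) \<le> \<rho>"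
  shows "hausdorff_measure s (eta ` (UNIV \<rightarrow> A)) = 0"
proof (rule hausdorff_measure_eq_0I[where b="\<lambda>_ r. 6 powr s * \<rho> ^ r"])
  show "(\<lambda>r. 6 powr s * \<rho> ^ r) \<longlonglongrightarrow> 0"
    using \<rho> by (intro tendsto_mult_right_zero LIMSEQ_power_zero) auto
  fix \<delta> :: real assume \<delta>: "0 < \<delta>"
  have "(\<lambda>r. 6 * (1/2 :: real) ^ r) \<longlonglongrightarrow> 0"
    by (intro tendsto_mult_right_zero LIMSEQ_power_zero) auto
  then have "\<forall>\<^sub>F r in sequentially. 6 * (1/2 :: real) ^ r < \<delta>"
    using \<delta> by (rule order_tendstoD)
  then show "\<forall>\<^sub>F r in sequentially. hausdorff_pre s \<delta> (eta ` (UNIV \<rightarrow> A)) \<le> ennreal (6 powr s * \<rho> ^ r)"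
  proof eventually_elim
    case (elim r)
    define V where "V w = eta ` {k \<in> UNIV \<rightarrow> A. map k [0..<r] = w}" for w
    \<comment> \<open>The value 0 off the words over \<open>A\<close> of length \<open>r\<close>,
      whose \<open>V w\<close> is empty, lets \<open>list_decode\<close> enumerate all
      lists.\<close>
    define c where "c w = (if set w \<subseteq> A \<and> length w = r then 6 powr s * (2 powr - s) ^ sum_list w else 0)" for w
    have V_empty: "V w = {}" if "\<not> (set w \<subseteq> A \<and> length w = r)" for w
      using that by (auto simp: V_def Pi_iff)
    have V_diff: "norm (u - v) \<le> 6 * (1/2) ^ sum_list w" if uv: "u \<in> V w" "v \<in> V w" for u v w
    proof -
      obtain k l where kl: "u = eta k" "v = eta l" "k \<in> UNIV \<rightarrow> A" "l \<in> UNIV \<rightarrow> A"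
          "map k [0..<r] = w" "map l [0..<r] = w"
        using uv by (auto simp: V_def)
      have "\<bar>eta k - eta l\<bar> \<le> 6 * (1/2) ^ sum_list (map k [0..<r])"
        by (rule eta_diff_le) (use kl A in auto)
      then show ?thesis using kl by simp
    qed
    have V_bounded: "bounded (V w)" for w
      unfolding bounded_two_points dist_norm using V_diff by blast
    have V_diam: "diameter (V w) \<le> 6 * (1/2) ^ sum_list w" for w
      by (rule diameter_le) (auto intro: V_diff[unfolded real_norm_def])
    have V_diam_\<delta>: "diameter (V w) \<le> \<delta>" for w
    proof (cases "V w = {}")
      case True
      then show ?thesis using \<delta> by simp
    next
      case False
      then obtain k where k: "k \<in> UNIV \<rightarrow> A" "map k [0..<r] = w" by (auto simp: V_def)
      have "1 \<le> k i" for i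
      proof -
        have "k i \<in> A" using k by auto
        from A[OF this] show ?thesis by simp
      qed
      then have "r \<le> sum_list w"
        using length_le_sum_list_upt[of k r] k by simp
      then have "(1/2 :: real) ^ sum_list w \<le> (1/2) ^ r"
        by (intro power_decreasing) auto
      then show ?thesis using V_diam[of w] elim by linarith
    qed
    have V_powr: "diameter (V w) powr s \<le> c w" for w
    proof (cases "set w \<subseteq> A \<and> length w = r")
      case True
      have "diameter (V w) powr s \<le> (6 * (1/2) ^ sum_list w) powr s"
        by (intro powr_mono2 V_diam diameter_ge_0 V_bounded) (use s in auto)
      also have "\<dots> = 6 powr s * (2 powr - s) ^ sum_list w"
        by (simp only: powr_mult powr_neg_power)
      finally show ?thesis using True by (simp add: c_def)
    next
      case False
      then show ?thesis using V_empty[OF False] by (auto simp: c_def)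
    qed
    have c_nonneg: "0 \<le> c w" for w by (simp add: c_def)
    have "hausdorff_pre s \<delta> (eta ` (UNIV \<rightarrow> A)) \<le> (\<Sum>i. ennreal (diameter (V (list_decode i)) powr s))"
      unfolding hausdorff_pre_def
    proof (rule INF_lower, safe)
      fix k :: "nat \<Rightarrow> nat" assume "k \<in> UNIV \<rightarrow> A"
      then show "eta k \<in> (\<Union>i. V (list_decode i))"
        by (auto simp: V_def intro!: exI[of _ "list_encode (map k [0..<r])"])
    qed (use V_bounded V_diam_\<delta> in auto)
    also have "\<dots> \<le> (\<Sum>i. ennreal (c (list_decode i)))"
      by (intro suminf_le summableI ennreal_leI V_powr)
    also have "\<dots> \<le> ennreal (6 powr s * \<rho> ^ r)"
    proof (rule suminf_le_const[OF summableI])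
      fix m
      \<comment> \<open>A partial sum meets finitely many words, hence a finite alphabet
        \<open>B\<close>, to which \<open>sum_words_power\<close> applies.\<close>
      define W where "W = list_decode ` {..<m}"
      define B where "B = A \<inter> \<Union> (set ` W)"
      have B: "finite B" "B \<subseteq> A" by (auto simp: B_def W_def)
      have inj: "inj_on list_decode {..<m}"
        using inj_list_decode by (rule inj_on_subset) auto
      have "(\<Sum>i<m. c (list_decode i)) = sum c W"
        unfolding W_def by (simp add: sum.reindex[OF inj])
      also have "\<dots> = sum c (W \<inter> {w. set w \<subseteq> A \<and> length w = r})"
        by (rule sum.mono_neutral_right) (auto simp: W_def c_def)
      also have "\<dots> \<le> sum c {w. set w \<subseteq> B \<and> length w = r}"
        using c_nonneg finite_lists_length_eq[OF B(1)] by (intro sum_mono2) (auto simp: B_def)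
      also have "\<dots> = (\<Sum>w\<in>{w. set w \<subseteq> B \<and> length w = r}. 6 powr s * (2 powr - s) ^ sum_list w)"
        using B by (intro sum.cong refl) (auto simp: c_def)
      also have "\<dots> = 6 powr s * (\<Sum>a\<in>B. (2 powr - s) ^ a) ^ r"
        by (simp only: sum_distrib_left[symmetric] sum_words_power[OF B(1)])
      also have "\<dots> \<le> 6 powr s * \<rho> ^ r"
        using B le by (intro mult_left_mono power_mono sum_nonneg) auto
      finally show "(\<Sum>i<m. ennreal (c (list_decode i))) \<le> ennreal (6 powr s * \<rho> ^ r)"
        by (subst sum_ennreal) (auto intro: c_nonneg ennreal_leI)
    qed
    finally show ?case .
  qed
qed

text \<open>
  Each set of a cover is replaced by the longest prefix common to the sequences it contains; sets
  with at most one sequence may have diameter 0 and get an arbitrarily long prefix instead.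
\<close>
lemma hausdorff_measure_eta_neq_0:
  assumes fin: "finite A" and A: "\<And>a. a \<in> A \<Longrightarrow> 2 \<le> a" and s: "0 < s"
    and ge: "1 \<le> (\<Sum>a\<in>A. (2 powr - s) ^ a)"
  shows "hausdorff_measure s (eta ` (UNIV \<rightarrow> A)) \<noteq> 0"
proof -
  define x where "x = 2 powr - s"
  have x: "0 < x" "x < 1" using s by (simp_all add: x_def powr_less_one)
  obtain q where q: "\<And>a. a \<in> A \<Longrightarrow> a \<le> q"
    using finite_nat_set_iff_bounded_le[THEN iffD1, OF fin] by auto
  obtain a0 where a0: "a0 \<in> A" using ge by (cases "A = {}") auto
  \<comment> \<open>The constant of \<open>eta_diff_ge\<close>: the separating letter is at most
    \<open>q\<close>, the bound of the finite alphabet.\<close>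
  define c where "c = ((1/2) ^ q / 3) powr s"
  have c: "0 < c" by (simp add: c_def)
  have dist_ge: "c * x ^ sum_list (map k [0..<n]) \<le> \<bar>eta k - eta l\<bar> powr s"
    if kl: "k \<in> UNIV \<rightarrow> A" "l \<in> UNIV \<rightarrow> A" "map k [0..<n] = map l [0..<n]" "k n < l n" for k l n
  proof -
    have "(1/2 :: real) ^ q \<le> (1/2) ^ k n"
      using q[of "k n"] kl by (intro power_decreasing) auto
    then have "(1/2) ^ sum_list (map k [0..<n]) * ((1/2) ^ q / 3)
        \<le> (1/2 :: real) ^ sum_list (map k [0..<n]) * ((1/2) ^ k n / 3)"
      by (intro mult_left_mono divide_right_mono) auto
    also have "\<dots> \<le> eta k - eta l"
      by (rule eta_diff_ge) (use kl A in auto)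
    also have "\<dots> \<le> \<bar>eta k - eta l\<bar>" by simp
    finally have "((1/2) ^ sum_list (map k [0..<n]) * ((1/2) ^ q / 3)) powr s \<le> \<bar>eta k - eta l\<bar> powr s"
      using s by (intro powr_mono2) auto
    then show ?thesis
      by (simp only: powr_mult powr_neg_power c_def x_def mult.commute)
  qed
  \<comment> \<open>The measure is a supremum over mesh sizes, so a positive lower bound at mesh 1
    suffices.\<close>
  have "ennreal c \<le> hausdorff_pre s 1 (eta ` (UNIV \<rightarrow> A))"
    unfolding hausdorff_pre_def
  proof (rule INF_greatest, clarify)
    fix U :: "nat \<Rightarrow> real set"
    assume cov: "eta ` (UNIV \<rightarrow> A) \<subseteq> (\<Union>i. U i)" and U: "\<forall>i. bounded (U i) \<and> diameter (U i) \<le> 1"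
    define V where "V i = {k \<in> UNIV \<rightarrow> A. eta k \<in> U i}" for i
    show "ennreal c \<le> (\<Sum>i. ennreal (diameter (U i) powr s))"
    proof (rule ennreal_le_epsilon)
      fix e :: real assume e: "0 < e"
      \<comment> \<open>The slack \<open>e * (1/2) ^ Suc i\<close> sums to \<open>e\<close> and pays
        for the sets with at most one sequence.\<close>
      have "\<exists>w. (\<forall>k\<in>V i. \<exists>r. w = map k [0..<r]) \<and>
          c * x ^ sum_list w \<le> diameter (U i) powr s + e * (1/2) ^ Suc i" for i
      proof (cases "\<exists>n. \<exists>k\<in>V i. \<exists>l\<in>V i. k n < l n")
        case True
        \<comment> \<open>First position where two members of \<open>V i\<close> disagree;
          minimality, applied in both orders, makes all members share the prefix before it.\<close>
        define n where "n = (LEAST n. \<exists>k\<in>V i. \<exists>l\<in>V i. k n < l n)"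
        obtain k l where kl: "k \<in> V i" "l \<in> V i" "k n < l n"
          using LeastI_ex[OF True] unfolding n_def by blast
        have agree: "map k [0..<n] = map k' [0..<n]" if "k' \<in> V i" for k'
        proof -
          have "k m = k' m" if "m < n" for m
            using not_less_Least[OF that[unfolded n_def]] kl(1) \<open>k' \<in> V i\<close>
            by (metis linorder_neqE_nat)
          then show ?thesis by simp
        qed
        have "c * x ^ sum_list (map k [0..<n]) \<le> \<bar>eta k - eta l\<bar> powr s"
          using kl(1,2) by (intro dist_ge agree kl(3)) (auto simp: V_def)
        also have "\<dots> \<le> diameter (U i) powr s"
          using diameter_bounded_bound[of "U i" "eta k" "eta l"] kl U s
          by (intro powr_mono2) (auto simp: V_def dist_real_def)
        also have "\<dots> \<le> diameter (U i) powr s + e * (1/2) ^ Suc i"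
          using e by simp
        finally have "c * x ^ sum_list (map k [0..<n]) \<le> diameter (U i) powr s + e * (1/2) ^ Suc i" .
        moreover have "\<forall>k'\<in>V i. \<exists>r. map k [0..<n] = map k' [0..<r]"
          using agree by blast
        ultimately show ?thesis by blast
      next
        case False
        have "\<exists>k\<in>UNIV \<rightarrow> A. V i \<subseteq> {k}"
        proof (cases "V i = {}")
          case True
          then show ?thesis using a0 by (intro bexI[of _ "\<lambda>_. a0"]) auto
        next
          case nonempty: False
          then obtain k where k: "k \<in> V i" by blast
          have "l = k" if "l \<in> V i" for l
            using False k that by (intro ext) (meson linorder_neqE_nat)
          then have "V i \<subseteq> {k}" by blast
          moreover have "k \<in> UNIV \<rightarrow> A" using k by (simp add: V_def)
          ultimately show ?thesis by blast
        qed
        then obtain k where k: "k \<in> UNIV \<rightarrow> A" "V i \<subseteq> {k}" by blast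
        have "(\<lambda>n. c * x ^ n) \<longlonglongrightarrow> 0"
          using x by (intro tendsto_mult_right_zero LIMSEQ_power_zero) auto
        moreover have "0 < e * (1/2) ^ Suc i" using e by simp
        ultimately have "\<forall>\<^sub>F n in sequentially. c * x ^ n < e * (1/2) ^ Suc i"
          by (rule order_tendstoD)
        then obtain n where n: "c * x ^ n < e * (1/2) ^ Suc i"
          by (auto simp: eventually_sequentially)
        have "1 \<le> k j" for j
        proof -
          have "k j \<in> A" using k by auto
          from A[OF this] show ?thesis by simp
        qed
        then have "n \<le> sum_list (map k [0..<n])"
          by (rule length_le_sum_list_upt)
        then have "c * x ^ sum_list (map k [0..<n]) \<le> c * x ^ n"
          using x c by (intro mult_left_mono power_decreasing) auto
        also have "\<dots> \<le> diameter (U i) powr s + e * (1/2) ^ Suc i"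
          using n powr_ge_zero[of "diameter (U i)" s] by linarith
        finally show ?thesis using k(2) by blast
      qed
      then obtain w where w: "\<And>i k. k \<in> V i \<Longrightarrow> \<exists>r. w i = map k [0..<r]"
          "\<And>i. c * x ^ sum_list (w i) \<le> diameter (U i) powr s + e * (1/2) ^ Suc i"
        by metis
      have "1 \<le> (\<Sum>i. ennreal (x ^ sum_list (w i)))"
      proof (rule prefix_words_sum_ge_1[OF fin x(1)])
        show "1 \<le> (\<Sum>a\<in>A. x ^ a)" using ge by (simp add: x_def)
        fix k :: "nat \<Rightarrow> nat" assume k: "k \<in> UNIV \<rightarrow> A"
        then obtain i where "eta k \<in> U i" using cov by blast
        then show "\<exists>i r. w i = map k [0..<r]"
          using w(1)[of k i] k by (auto simp: V_def)
      qed
      then have "ennreal c * 1 \<le> ennreal c * (\<Sum>i. ennreal (x ^ sum_list (w i)))"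
        by (intro mult_left_mono) auto
      also have "\<dots> = (\<Sum>i. ennreal (c * x ^ sum_list (w i)))"
        using c x by (simp add: ennreal_mult)
      also have "\<dots> \<le> (\<Sum>i. ennreal (diameter (U i) powr s) + ennreal (e * (1/2) ^ Suc i))"
        using w(2) e
        by (intro suminf_le summableI) (simp add: ennreal_leI del: power_Suc flip: ennreal_plus)
      also have "\<dots> = (\<Sum>i. ennreal (diameter (U i) powr s)) + (\<Sum>i. ennreal (e * (1/2) ^ Suc i))"
        by (intro suminf_add[symmetric] summableI)
      also have "(\<Sum>i. ennreal (e * (1/2) ^ Suc i)) = ennreal e"
        using sums_mult[OF power_half_series, of e] e by (intro suminf_ennreal_eq) auto
      finally show "ennreal c \<le> (\<Sum>i. ennreal (diameter (U i) powr s)) + ennreal e" by simp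
    qed
  qed
  also have "\<dots> \<le> hausdorff_measure s (eta ` (UNIV \<rightarrow> A))"
    unfolding hausdorff_measure_def by (rule SUP_upper) auto
  finally show ?thesis using c by auto
qed

text \<open>
  The line is covered by intervals of lengths \<open>c/i\<close>: their sum diverges, while the sum of squares is
  a multiple of \<open>c\<^sup>2\<close>. Membership of 2 keeps the infimum defining \<open>hausdorff_dim\<close> from being taken
  over the empty set.
\<close>
lemma hausdorff_measure_2_eq_0: "hausdorff_measure 2 (A :: real set) = 0"
proof (rule hausdorff_measure_eq_0I)
  let ?b = "\<lambda>n. (2 / real (Suc n))\<^sup>2 * (pi\<^sup>2 / 6)"
  show "?b \<longlonglongrightarrow> 0" by real_asymp
  fix \<delta> :: real assume \<delta>: "0 < \<delta>"
  have "(\<lambda>n. 1 / real (Suc n)) \<longlonglongrightarrow> 0" by real_asymp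
  then have "\<forall>\<^sub>F n in sequentially. 1 / real (Suc n) < \<delta>"
    using \<delta> by (rule order_tendstoD)
  then show "\<forall>\<^sub>F n in sequentially. hausdorff_pre 2 \<delta> A \<le> ennreal (?b n)"
  proof eventually_elim
    case (elim n)
    define c where "c = 1 / real (Suc n)"
    have c: "0 < c" "c < \<delta>" using elim by (auto simp: c_def)
    \<comment> \<open>Intervals between consecutive multiples \<open>c * harm j\<close> fill the
      half-line because \<open>harm\<close> diverges. Each is listed twice: even indices serve the
      right half-line, odd ones its mirror image.\<close>
    define I where "I i = {c * harm (i div 2) .. c * harm (Suc (i div 2))}" for i
    define U where "U i = (if even i then I i else uminus ` I i)" for i
    have U_diff: "norm (u - v) \<le> c / real (Suc (i div 2))" if "u \<in> U i" "v \<in> U i" for u v i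
      using that by (auto simp: U_def I_def harm_Suc abs_le_iff algebra_simps divide_inverse split: if_splits)
    have U_bounded: "bounded (U i)" for i
      unfolding bounded_two_points dist_norm using U_diff by blast
    have U_diam: "diameter (U i) \<le> c / real (Suc (i div 2))" for i
      by (rule diameter_le) (use c U_diff[of _ i] in auto)
    have "c / real (Suc (i div 2)) \<le> c / 1" for i
      using c by (intro frac_le) auto
    then have U_diam_\<delta>: "diameter (U i) \<le> \<delta>" for i
      using U_diam[of i] c by (smt (verit) div_by_1)
    have U_sq: "diameter (U i) powr 2 \<le> (2 / real (Suc n))\<^sup>2 * (1 / (real i + 1)\<^sup>2)" for i
    proof -
      have "Suc i \<le> 2 * Suc (i div 2)" by presburger
      then have "real (Suc i) \<le> real (2 * Suc (i div 2))" by (rule of_nat_mono)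
      then have "real (Suc i) / 2 \<le> real (Suc (i div 2))" by simp
      then have "c / real (Suc (i div 2)) \<le> c / (real (Suc i) / 2)"
        using c by (intro divide_left_mono) auto
      then have "diameter (U i) powr 2 \<le> (c / (real (Suc i) / 2)) powr 2"
        using U_diam[of i] by (intro powr_mono2 diameter_ge_0 U_bounded) auto
      also have "\<dots> = (c / (real (Suc i) / 2))\<^sup>2"
        using c by simp
      also have "\<dots> = (2 / real (Suc n))\<^sup>2 * (1 / (real i + 1)\<^sup>2)"
        by (simp add: c_def power_divide power_mult_distrib[symmetric] algebra_simps)
      finally show ?thesis .
    qed
    have cover: "\<exists>i. y \<in> U i" for y
    proof -
      have "\<forall>\<^sub>F m in sequentially. \<bar>y\<bar> / c < harm m"
        using filterlim_at_top_dense[THEN iffD1, OF harm_at_top] by blast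
      then have ex: "\<exists>m. \<bar>y\<bar> / c < harm m" by (auto simp: eventually_sequentially)
      define m where "m = (LEAST m. \<bar>y\<bar> / c < harm m)"
      have m: "\<bar>y\<bar> / c < harm m"
        unfolding m_def by (rule LeastI_ex[OF ex])
      have "m \<noteq> 0"
      proof
        assume "m = 0"
        with m have "\<bar>y\<bar> / c < 0" by (simp add: harm_def)
        then show False using c by (simp add: divide_less_0_iff)
      qed
      then obtain j where j: "m = Suc j" by (cases m) auto
      then have "harm j \<le> \<bar>y\<bar> / c"
        using not_less_Least[of j "\<lambda>m. \<bar>y\<bar> / c < harm m"] unfolding m_def by simp
      then have "\<bar>y\<bar> \<in> I (2 * j)" "\<bar>y\<bar> \<in> I (2 * j + 1)"
        using m j c by (auto simp: I_def field_simps)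
      then have "y \<in> U (if 0 \<le> y then 2 * j else 2 * j + 1)"
        by (auto simp: U_def intro!: image_eqI[of _ uminus "- y"])
      then show ?thesis by blast
    qed
    have "hausdorff_pre 2 \<delta> A \<le> (\<Sum>i. ennreal (diameter (U i) powr 2))"
      unfolding hausdorff_pre_def
      by (rule INF_lower) (use cover U_bounded U_diam_\<delta> in auto)
    also have "\<dots> \<le> (\<Sum>i. ennreal ((2 / real (Suc n))\<^sup>2 * (1 / (real i + 1)\<^sup>2)))"
      by (intro suminf_le summableI ennreal_leI U_sq)
    also have "\<dots> = ennreal (?b n)"
      using sums_mult[OF inverse_squares_sums, of "(2 / real (Suc n))\<^sup>2"]
      by (intro suminf_ennreal_eq) (auto simp: add.commute)
    finally show ?case .
  qed
qed

section \<open>Monotonicity of the dimension and its determination from a critical exponent\<close>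

lemma hausdorff_dim_mono:
  assumes "A \<subseteq> B"
  shows "hausdorff_dim A \<le> hausdorff_dim B"
  unfolding hausdorff_dim_def
proof (rule cInf_superset_mono)
  show "{s. 0 < s \<and> hausdorff_measure s B = 0} \<noteq> {}"
    using hausdorff_measure_2_eq_0 by (auto intro!: exI[of _ 2])
  show "bdd_below {s. 0 < s \<and> hausdorff_measure s A = 0}"
    by (rule bdd_belowI[of _ 0]) auto
  show "{s. 0 < s \<and> hausdorff_measure s B = 0} \<subseteq> {s. 0 < s \<and> hausdorff_measure s A = 0}"
    using hausdorff_measure_mono[OF assms] by (auto simp: le_zero_eq) (metis le_zero_eq)
qed

lemma hausdorff_dim_eqI:
  assumes "0 \<le> d" and zero: "\<And>s. d < s \<Longrightarrow> hausdorff_measure s A = 0"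
    and pos: "\<And>s. 0 < s \<Longrightarrow> s < d \<Longrightarrow> hausdorff_measure s A \<noteq> 0"
  shows "hausdorff_dim A = d"
  unfolding hausdorff_dim_def
proof (rule antisym)
  let ?S = "{s. 0 < s \<and> hausdorff_measure s A = 0}"
  have mem: "d + e \<in> ?S" if "0 < e" for e
    using that assms by auto
  show "d \<le> Inf ?S"
    using mem[of 1] pos by (intro cInf_greatest) (auto simp: not_less[symmetric])
  show "Inf ?S \<le> d"
    by (rule field_le_epsilon) (auto intro!: cInf_lower bdd_belowI[of _ 0] mem)
qed

section \<open>Sequence spaces, defining equations of the roots, and the dimension formulas\<close>

lemma T_p_eq:
  assumes "2 \<le> p"
  shows "T_p p = UNIV \<rightarrow> {p..}"
proof -
  \<comment> \<open>As \<open>p >= 2\<close>, every letter is at least 2 and the extra conditions in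
    \<open>T_set\<close> hold, so \<open>T_p p\<close> is a full product space.\<close>
  have "k \<in> T_set" if "\<And>i. p \<le> k i" for k
  proof -
    have "2 \<le> k i" for i using that[of i] assms by simp
    moreover from this have "1 \<le> k i" for i by (meson one_le_numeral order_trans)
    ultimately show ?thesis unfolding T_set_def by blast
  qed
  then show ?thesis by (auto simp: T_p_def)
qed

lemma T_p_Int_D_p_eq: "2 \<le> p \<Longrightarrow> T_p p \<inter> D_p q = UNIV \<rightarrow> {p..q}"
  using T_p_eq[of p] by (auto simp: D_p_def T_p_def Pi_iff)

text \<open>Makes the \<open>THE\<close> terms of the theorem meaningful: existence by the
  intermediate value theorem, uniqueness by strict monotonicity.\<close>

lemma ex1_root_in_Ioo:
  fixes f :: "real \<Rightarrow> real"
  assumes "continuous_on {a..b} f" "a < b" "f a < c" "c < f b" "strict_mono_on {a<..<b} f"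
  shows "\<exists>!x. a < x \<and> x < b \<and> f x = c"
proof -
  obtain x where x: "a \<le> x" "x \<le> b" "f x = c"
    using IVT'[of f a c b] assms by auto
  then have "a < x" "x < b" using assms by (auto simp: less_le)
  moreover have "y = x" if "a < y" "y < b" "f y = c" for y
    using strict_mono_on_imp_inj_on[OF assms(5)] that x calculation by (auto dest: inj_onD)
  ultimately show ?thesis using x by blast
qed

lemma alpha_ex1:
  assumes "2 \<le> p"
  shows "\<exists>!x::real. 1 < x \<and> x < 2 \<and> x ^ (p - 1) * (x - 1) = 1"
proof (rule ex1_root_in_Ioo)
  show "strict_mono_on {1<..<2} (\<lambda>x::real. x ^ (p - 1) * (x - 1))"
    by (rule strict_mono_onI) (auto intro!: mult_le_less_imp_less power_mono)
  have "(2::real) ^ 1 \<le> 2 ^ (p - 1)"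
    using assms by (intro power_increasing) auto
  then show "(1::real) < 2 ^ (p - 1) * (2 - 1)" by simp
qed (auto intro!: continuous_intros)

lemma sum_power_strict_mono:
  fixes x y :: real
  assumes "0 \<le> x" "x < y" "1 \<le> p" "p \<le> q"
  shows "(\<Sum>i=p..q. x ^ i) < (\<Sum>i=p..q. y ^ i)"
  using assms by (intro sum_strict_mono power_strict_mono) auto

lemma gamma_ex1:
  assumes "1 \<le> p" "p < q"
  shows "\<exists>!x::real. 0 < x \<and> x < 1 \<and> (\<Sum>i=p..q. x ^ i) = 1"
proof (rule ex1_root_in_Ioo)
  show "strict_mono_on {0<..<1} (\<lambda>x::real. \<Sum>i=p..q. x ^ i)"
    using assms by (intro strict_mono_onI sum_power_strict_mono) auto
  have "(\<Sum>i=p..q. (0::real) ^ i) = 0"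
    using assms by (intro sum.neutral) auto
  then show "(\<Sum>i=p..q. (0::real) ^ i) < 1" by simp
qed (use assms in \<open>auto intro!: continuous_intros\<close>)

text \<open>\<open>2 powr - s\<close> equals the root \<open>x\<close> exactly at the claimed
  dimension, and the letter sum is strictly increasing in it, so each measure criterion applies on
  its side.\<close>

lemma hausdorff_dim_T_p_Int_D_p:
  assumes p: "2 \<le> p" "p < q" and x: "0 < x" "x < 1" "(\<Sum>i=p..q. x ^ i) = 1"
  shows "hausdorff_dim (eta ` (T_p p \<inter> D_p q)) = ln (1 / x) / ln 2"
proof (rule hausdorff_dim_eqI)
  let ?d = "ln (1 / x) / ln 2"
  show d: "0 \<le> ?d" using x by simp
  have x_eq: "x = 2 powr - ?d" using x by (simp add: powr_def ln_div)
  show "hausdorff_measure s (eta ` (T_p p \<inter> D_p q)) = 0" if s: "?d < s" for s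
    unfolding T_p_Int_D_p_eq[OF p(1)]
  proof (rule hausdorff_measure_eta_eq_0)
    have "2 powr - s < x" using s by (subst x_eq) simp
    then show "(\<Sum>i=p..q. (2 powr - s) ^ i) < 1"
      using sum_power_strict_mono[of "2 powr - s" x p q] p x by simp
    show "(\<Sum>a\<in>B. (2 powr - s) ^ a) \<le> (\<Sum>i=p..q. (2 powr - s) ^ i)" if "B \<subseteq> {p..q}" for B
      using that by (intro sum_mono2) auto
  qed (use p s d in \<open>auto intro: sum_nonneg\<close>)
  show "hausdorff_measure s (eta ` (T_p p \<inter> D_p q)) \<noteq> 0" if s: "0 < s" "s < ?d" for s
    unfolding T_p_Int_D_p_eq[OF p(1)]
  proof (rule hausdorff_measure_eta_neq_0)
    have "x < 2 powr - s" using s by (subst x_eq) simp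
    then show "1 \<le> (\<Sum>i=p..q. (2 powr - s) ^ i)"
      using sum_power_strict_mono[of x "2 powr - s" p q] p x by simp
  qed (use p s in auto)
qed

lemma sum_power_shift_tendsto:
  fixes y :: real
  assumes "0 \<le> y" "y < 1"
  shows "(\<lambda>N. \<Sum>i=p..<p + N. y ^ i) \<longlonglongrightarrow> y ^ p / (1 - y)"
proof -
  have "(\<lambda>i. y ^ p * y ^ i) sums (y ^ p * (1 / (1 - y)))"
    using assms by (intro sums_mult geometric_sums) auto
  moreover have "(\<Sum>i=p..<p + N. y ^ i) = (\<Sum>i<N. y ^ p * y ^ i)" for N
    by (rule sum.reindex_bij_witness[of _ "\<lambda>i. p + i" "\<lambda>i. i - p"]) (auto simp flip: power_add)
  ultimately show ?thesis by (simp add: sums_def)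
qed

text \<open>With \<open>x = 1/\<alpha>\<close> the equation becomes
  \<open>x^p / (1 - x) = 1\<close>: the geometric series of \<open>x^a\<close> over all
  \<open>a >= p\<close> equals 1, the letter-sum condition for an infinite alphabet.\<close>

lemma hausdorff_dim_T_p:
  assumes p: "2 \<le> p" and \<alpha>: "1 < \<alpha>" "\<alpha> < 2" "\<alpha> ^ (p - 1) * (\<alpha> - 1) = 1"
  shows "hausdorff_dim (eta ` T_p p) = ln \<alpha> / ln 2"
proof (rule hausdorff_dim_eqI)
  let ?d = "ln \<alpha> / ln 2"
  show d: "0 \<le> ?d" using \<alpha> by simp
  define x where "x = 1 / \<alpha>"
  have x: "0 < x" "x < 1" using \<alpha> by (auto simp: x_def)
  have x_eq: "x = 2 powr - ?d" using \<alpha> by (simp add: x_def powr_def exp_minus inverse_eq_divide)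
  have "x ^ p * (\<alpha> ^ (p - 1) * (\<alpha> - 1)) = x ^ p * \<alpha> ^ p * (1 - x)"
    using p \<alpha> by (cases p) (auto simp: x_def field_simps)
  then have x_root: "x ^ p = 1 - x"
    using \<alpha> by (simp add: x_def power_divide)
  show "hausdorff_measure s (eta ` T_p p) = 0" if s: "?d < s" for s
    unfolding T_p_eq[OF p]
  proof (rule hausdorff_measure_eta_eq_0)
    define y where "y = 2 powr - s"
    have y: "0 < y" "y < x" using s by (simp_all add: y_def x_eq)
    have "y ^ p < 1 - y"
      using power_strict_mono[of y x p] y p x_root by simp
    then show "(2 powr - s) ^ p / (1 - 2 powr - s) < 1"
      using y x by (simp add: y_def[symmetric])
    show "0 \<le> (2 powr - s) ^ p / (1 - 2 powr - s)"
      using y x by (simp add: y_def[symmetric])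
    show "(\<Sum>a\<in>B. (2 powr - s) ^ a) \<le> (2 powr - s) ^ p / (1 - 2 powr - s)"
      if B: "finite B" "B \<subseteq> {p..}" for B
      unfolding y_def[symmetric]
    proof (rule LIMSEQ_le_const[OF sum_power_shift_tendsto])
      obtain N where N: "B \<subseteq> {..<N}"
        using B finite_nat_iff_bounded by auto
      have "(\<Sum>a\<in>B. y ^ a) \<le> (\<Sum>i=p..<p + n. y ^ i)" if "N \<le> n" for n
      proof (rule sum_mono2)
        show "B \<subseteq> {p..<p + n}"
        proof
          fix b assume "b \<in> B"
          then have "p \<le> b" "b < N" using B(2) N by auto
          then show "b \<in> {p..<p + n}" using that by simp
        qed
      qed (use y in auto)
      then show "\<exists>N. \<forall>n\<ge>N. (\<Sum>a\<in>B. y ^ a) \<le> (\<Sum>i=p..<p + n. y ^ i)" by blast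
    qed (use x y in auto)
  qed (use p s d in auto)
  show "hausdorff_measure s (eta ` T_p p) \<noteq> 0" if s: "0 < s" "s < ?d" for s
  proof -
    define y where "y = 2 powr - s"
    have y: "x < y" "y < 1" using s by (auto simp: y_def powr_less_one x_eq)
    have "1 - y < y ^ p"
      using power_strict_mono[of x y p] x y p x_root by simp
    then have "1 < y ^ p / (1 - y)" using y by simp
    \<comment> \<open>Below the dimension the infinite letter sum exceeds 1, so a finite piece of
      the alphabet already does; monotonicity transfers positivity to \<open>T_p p\<close>.\<close>
    then have "\<forall>\<^sub>F N in sequentially. 1 < (\<Sum>i=p..<p + N. y ^ i)"
      using sum_power_shift_tendsto[of y p] x y by (intro order_tendstoD) auto
    then obtain N where N: "1 < (\<Sum>i=p..<p + N. y ^ i)"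
      by (auto simp: eventually_sequentially)
    have "hausdorff_measure s (eta ` (UNIV \<rightarrow> {p..<p + N})) \<noteq> 0"
      by (rule hausdorff_measure_eta_neq_0) (use N p s in \<open>auto simp: y_def\<close>)
    moreover have "hausdorff_measure s (eta ` (UNIV \<rightarrow> {p..<p + N})) \<le> hausdorff_measure s (eta ` T_p p)"
      unfolding T_p_eq[OF p] by (intro hausdorff_measure_mono image_mono) auto
    ultimately show ?thesis by (metis le_zero_eq)
  qed
qed

theorem theorem1p5:
  shows "(\<forall>p::nat. 2 \<le> p \<longrightarrow>
           hausdorff_dim (eta ` T_p p)
             = ln (THE x::real. 1 < x \<and> x < 2 \<and> x ^ (p - 1) * (x - 1) = 1) / ln 2)
       \<and> (\<forall>p q::nat. 2 \<le> p \<and> p < q \<longrightarrow>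
           hausdorff_dim (eta ` (T_p p \<inter> D_p q))
             = ln (1 / (THE x::real. 0 < x \<and> x < 1 \<and> (\<Sum>i=p..q. x ^ i) = 1)) / ln 2)
       \<and> (\<forall>q::nat. 3 \<le> q \<longrightarrow>
           hausdorff_dim (eta ` D_p q)
             \<ge> ln (1 / (THE x::real. 0 < x \<and> x < 1 \<and> (\<Sum>i=2..q. x ^ i) = 1)) / ln 2)"
proof (intro conjI allI impI)
  show "hausdorff_dim (eta ` T_p p)
      = ln (THE x::real. 1 < x \<and> x < 2 \<and> x ^ (p - 1) * (x - 1) = 1) / ln 2" if "2 \<le> p" for p
    using theI'[OF alpha_ex1[OF that]] that by (intro hausdorff_dim_T_p) auto
  have dim_eq: "hausdorff_dim (eta ` (T_p p \<inter> D_p q))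
      = ln (1 / (THE x::real. 0 < x \<and> x < 1 \<and> (\<Sum>i=p..q. x ^ i) = 1)) / ln 2"
    if "2 \<le> p" "p < q" for p q
    using theI'[OF gamma_ex1[of p q]] that by (intro hausdorff_dim_T_p_Int_D_p) auto
  then show "hausdorff_dim (eta ` (T_p p \<inter> D_p q))
      = ln (1 / (THE x::real. 0 < x \<and> x < 1 \<and> (\<Sum>i=p..q. x ^ i) = 1)) / ln 2"
    if "2 \<le> p \<and> p < q" for p q
    using that by blast
  show "hausdorff_dim (eta ` D_p q)
      \<ge> ln (1 / (THE x::real. 0 < x \<and> x < 1 \<and> (\<Sum>i=2..q. x ^ i) = 1)) / ln 2" if "3 \<le> q" for q
    using dim_eq[of 2 q] hausdorff_dim_mono[of "eta ` (T_p 2 \<inter> D_p q)" "eta ` D_p q"] that by auto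
qed

end
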